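(* Let $X$ be a Banach space admitting an equivalent norm with property $(\beta_p)$ for some $p\in(1,\infty)$. Assume that a Banach space $Y$ is a uniform subquotient of $X$, where the uniform quotient map is Lipschitz for large distances (i.e. there are a subset $Z\subset X$ and a uniform quotient map $f\colon Z\to Y$ that is Lipschitz for large distances). Then for any $q\in(p,\infty)$, $\ell_q$ is not a uniform subquotient of $Y$ via a uniform quotient map that is Lipschitz for large distances (i.e. there are no subset $S\subset Y$ and uniform quotient map $g\colon S\to\ell_q$ that is Lipschitz for large distances).
   Context: All metric spaces are nonempty and $B_M(x,r)$ denotes the closed ball of a metric space $M$. A map $f\colon M\to N$ between metric spaces is a uniform quotient map if there are non-decreasing functions $\rho,\omega\colon[0,\infty)\to[0,\infty)$ with $\lim_{t\to0}\omega(t)=0$ and $\rho(t)>0$ for all $t>0$ such that for all $x\in M$ and $r\in(0,\infty)$, $B_N(f(x),\rho(r))\subset f(B_M(x,r))\subset B_N(f(x),\omega(r))$. $N$ is a uniform subquotient of $M$ if there is a uniform quotient map from a subset of $M$ to $N$. A map $f\colon M\to N$ is Lipschitz for large distances if for every $s\in(0,\infty)$ there is $L\in(0,\infty)$ (depending on $s$) such that $f(B_M(x,r))\subset B_N(f(x),Lr)$ for all $r\ge s$ and $x\in M$. For a Banach space $X$ with closed unit ball $B_X$ and a sequence $(y_i)$, put $\mathrm{sep}(\{y_i\}_{i=1}^\infty)=\inf\{\|y_n-y_m\|: n\ne m\}$ and $$\bar\beta_X(t)=1-\sup\left\{\inf_{i\ge1}\frac{\|x-y_i\|}{2}\colon x\in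 B_X,\ (y_i)_{i=1}^\infty\subset B_X,\ \mathrm{sep}(\{y_i\})\ge t\right\},$$ defined on an interval $[0,a]$ (those $t$ for which such sequences exist), where $a\in[1,2]$ depends on $X$. $X$ has property $(\beta_p)$ if there is $\gamma\in(0,\infty)$ with $\bar\beta_X(t)\ge\gamma t^p$ for all $t\in[0,a]$. *)

theory Defs
  imports "HOL-Analysis.Analysis"
begin

section \<open>Uniform quotient maps\<close>

text \<open>Metric spaces are nonempty by convention. The condition on \<open>M\<close> is not redundant here:
  without it the empty map would be a uniform quotient map onto every space.\<close>

definition uniform_quotient_map :: "'a metric \<Rightarrow> 'b metric \<Rightarrow> ('a \<Rightarrow> 'b) \<Rightarrow> bool" where
  "uniform_quotient_map M N f \<longleftrightarrow>
     mspace M \<noteq> {} \<and> mspace N \<noteq> {} \<and> f \<in> mspace M \<rightarrow> mspace N \<and>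
     (\<exists>\<rho> \<omega> :: real \<Rightarrow> real.
        \<rho> \<in> {0..} \<rightarrow> {0..} \<and> \<omega> \<in> {0..} \<rightarrow> {0..} \<and>
        mono_on {0..} \<rho> \<and> mono_on {0..} \<omega> \<and>
        (\<omega> \<longlongrightarrow> 0) (at 0 within {0..}) \<and> (\<forall>t>0. \<rho> t > 0) \<and>
        (\<forall>x\<in>mspace M. \<forall>r>0.
           mcball_of N (f x) (\<rho> r) \<subseteq> f ` mcball_of M x r \<and>
           f ` mcball_of M x r \<subseteq> mcball_of N (f x) (\<omega> r)))"

definition lipschitz_for_large_distances :: "'a metric \<Rightarrow> 'b metric \<Rightarrow> ('a \<Rightarrow> 'b) \<Rightarrow> bool" where
  "lipschitz_for_large_distances M N f \<longleftrightarrow>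
     (\<forall>s>0. \<exists>L>0. \<forall>r\<ge>s. \<forall>x\<in>mspace M.
        f ` mcball_of M x r \<subseteq> mcball_of N (f x) (L * r))"


section \<open>Property \<open>(\<beta>\<^sub>p)\<close>\<close>

text \<open>Norms are passed as functions \<open>N\<close> so that renormings of one and the same type can be
  discussed. Sequences are indexed from \<open>0\<close>.\<close>

definition equivalent_norm :: "('a::real_normed_vector \<Rightarrow> real) \<Rightarrow> bool" where
  "equivalent_norm N \<longleftrightarrow>
     (\<forall>x. N x = 0 \<longleftrightarrow> x = 0) \<and> (\<forall>x y. N (x + y) \<le> N x + N y) \<and>
     (\<forall>a x. N (a *\<^sub>R x) = \<bar>a\<bar> * N x) \<and>
     (\<exists>c>0. \<exists>C>0. \<forall>x. c * norm x \<le> N x \<and> N x \<le> C * norm x)"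

definition sep :: "('a::real_vector \<Rightarrow> real) \<Rightarrow> (nat \<Rightarrow> 'a) \<Rightarrow> real" where
  "sep N y = Inf {N (y n - y m) | n m. n \<noteq> m}"

definition separated_seqs :: "('a::real_vector \<Rightarrow> real) \<Rightarrow> real \<Rightarrow> (nat \<Rightarrow> 'a) set" where
  "separated_seqs N t = {y. (\<forall>i. N (y i) \<le> 1) \<and> sep N y \<ge> t}"

definition beta_modulus :: "('a::real_vector \<Rightarrow> real) \<Rightarrow> real \<Rightarrow> real" where
  "beta_modulus N t =
     1 - Sup {(INF i. N (x - y i) / 2) | x y. N x \<le> 1 \<and> y \<in> separated_seqs N t}"

text \<open>The inequality is required exactly on the domain of the modulus, i.e. for those \<open>t \<ge> 0\<close>
  for which some \<open>t\<close>-separated sequence in the unit ball exists.\<close>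

definition property_beta :: "('a::real_vector \<Rightarrow> real) \<Rightarrow> real \<Rightarrow> bool" where
  "property_beta N p \<longleftrightarrow>
     (\<exists>\<gamma>>0. \<forall>t\<ge>0. separated_seqs N t \<noteq> {} \<longrightarrow> beta_modulus N t \<ge> \<gamma> * t powr p)"


section \<open>The sequence space \<open>\<ell>\<^sub>q\<close>\<close>

definition lq_space :: "real \<Rightarrow> (nat \<Rightarrow> real) set" where
  "lq_space q = {x. summable (\<lambda>n. \<bar>x n\<bar> powr q)}"

definition lq_norm :: "real \<Rightarrow> (nat \<Rightarrow> real) \<Rightarrow> real" where
  "lq_norm q x = (\<Sum>n. \<bar>x n\<bar> powr q) powr (1 / q)"

definition lq_metric :: "real \<Rightarrow> (nat \<Rightarrow> real) metric" where
  "lq_metric q = metric (lq_space q, \<lambda>x y. lq_norm q (\<lambda>n. x n - y n))"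

text \<open>The abstraction function \<open>metric\<close> is only meaningful on genuine metrics, so we
  verify the axioms for \<open>q \<ge> 1\<close>.\<close>

lemma lq_norm_nonneg [simp]: "0 \<le> lq_norm q x"
  by (simp add: lq_norm_def)

lemma lq_norm_powr:
  assumes "q \<ge> 1" "x \<in> lq_space q"
  shows "lq_norm q x powr q = (\<Sum>n. \<bar>x n\<bar> powr q)"
  using assms by (simp add: lq_norm_def powr_powr lq_space_def suminf_nonneg)

lemma lq_norm_eq_0_iff:
  assumes "q \<ge> 1" "x \<in> lq_space q"
  shows "lq_norm q x = 0 \<longleftrightarrow> (\<forall>n. x n = 0)"
  using assms suminf_eq_zero_iff[of "\<lambda>n. \<bar>x n\<bar> powr q"]
  by (auto simp: lq_norm_def lq_space_def)

lemma powr_convex_comb: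
  fixes q :: real
  assumes q: "q \<ge> 1" and u: "0 \<le> u" "0 \<le> v" "u + v = 1" and a: "0 \<le> a" "0 \<le> b"
  shows "(u * a + v * b) powr q \<le> u * a powr q + v * b powr q"
proof -
  have *: "(w * c) powr q \<le> w * c powr q" if "0 \<le> w" "w \<le> 1" "0 \<le> c" for w c :: real
  proof (cases "w = 0")
    case False
    then have "w powr q \<le> w powr 1"
      using that q by (intro powr_mono') auto
    then show ?thesis
      using that by (auto simp: powr_mult intro: mult_right_mono)
  qed auto
  show ?thesis
  proof (cases "a = 0 \<or> b = 0")
    case True
    then show ?thesis
      using *[of u a] *[of v b] u a by auto
  next
    case False
    have u_eq: "u = 1 - v"
      using u by simp
    show ?thesis
      unfolding u_eq using False convex_onD[OF powr_convex[OF q], of v a b] u a by simp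
  qed
qed

lemma lq_triangle:
  assumes q: "q \<ge> 1" and x: "x \<in> lq_space q" and y: "y \<in> lq_space q"
  shows "(\<lambda>n. x n + y n) \<in> lq_space q"
    and "lq_norm q (\<lambda>n. x n + y n) \<le> lq_norm q x + lq_norm q y"
proof -
  have bound: "(\<lambda>n. x n + y n) \<in> lq_space q \<and>
      lq_norm q (\<lambda>n. x n + y n) \<le> a + b"
    if a: "a > 0" "lq_norm q x \<le> a" and b: "b > 0" "lq_norm q y \<le> b" for a b
  proof -
    have ab: "a / (a + b) + b / (a + b) = 1"
      using a b by (simp flip: add_divide_distrib)
    let ?g = "\<lambda>n. (a + b) powr q *
      (a / (a + b) * (\<bar>x n\<bar> powr q / a powr q) + b / (a + b) * (\<bar>y n\<bar> powr q / b powr q))"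
    have le: "\<bar>x n + y n\<bar> powr q \<le> ?g n" for n
    proof -
      have "\<bar>x n + y n\<bar> powr q \<le> ((a + b) * (a / (a + b) * (\<bar>x n\<bar> / a) + b / (a + b) * (\<bar>y n\<bar> / b))) powr q"
      proof (rule powr_mono2)
        have "a + b \<noteq> 0" using a b by linarith
        then have "(a + b) * (a / (a + b) * (\<bar>x n\<bar> / a) + b / (a + b) * (\<bar>y n\<bar> / b)) = \<bar>x n\<bar> + \<bar>y n\<bar>"
          using a b by (simp add: distrib_left)
        then show "\<bar>x n + y n\<bar> \<le> (a + b) * (a / (a + b) * (\<bar>x n\<bar> / a) + b / (a + b) * (\<bar>y n\<bar> / b))"
          by simp
      qed (use q in auto)
      also have "\<dots> = (a + b) powr q * (a / (a + b) * (\<bar>x n\<bar> / a) + b / (a + b) * (\<bar>y n\<bar> / b)) powr q"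
        using a b by (intro powr_mult)
      also have "\<dots> \<le> (a + b) powr q *
          (a / (a + b) * (\<bar>x n\<bar> / a) powr q + b / (a + b) * (\<bar>y n\<bar> / b) powr q)"
        using a b q by (intro mult_left_mono powr_convex_comb ab) auto
      also have "\<dots> = ?g n"
        using a b by (simp add: powr_divide)
      finally show ?thesis .
    qed
    have sx: "summable (\<lambda>n. \<bar>x n\<bar> powr q)" and sy: "summable (\<lambda>n. \<bar>y n\<bar> powr q)"
      using x y by (auto simp: lq_space_def)
    have sg: "?g sums ((a + b) powr q * (a / (a + b) * (lq_norm q x powr q / a powr q)
        + b / (a + b) * (lq_norm q y powr q / b powr q)))"
      unfolding lq_norm_powr[OF q x] lq_norm_powr[OF q y]
      by (intro sums_mult sums_add sums_divide summable_sums sx sy)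
    have sum: "summable (\<lambda>n. \<bar>x n + y n\<bar> powr q)"
      by (rule summable_comparison_test'[OF sums_summable[OF sg], of 0]) (use le in auto)
    have "(\<Sum>n. \<bar>x n + y n\<bar> powr q) \<le> (a + b) powr q * (a / (a + b) * (lq_norm q x powr q / a powr q)
        + b / (a + b) * (lq_norm q y powr q / b powr q))"
      using suminf_le[OF le sum sums_summable[OF sg]] sums_unique[OF sg] by simp
    also have "\<dots> \<le> (a + b) powr q * (a / (a + b) * 1 + b / (a + b) * 1)"
      using a b q by (intro mult_left_mono add_mono) (auto simp: powr_mono2)
    also have "\<dots> = (a + b) powr q"
      using a b by (simp flip: add_divide_distrib)
    finally have "lq_norm q (\<lambda>n. x n + y n) \<le> ((a + b) powr q) powr (1 / q)"
      unfolding lq_norm_def using q by (intro powr_mono2) (auto intro: suminf_nonneg sum)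
    also have "\<dots> = a + b"
      using a b q by (simp add: powr_powr)
    finally show ?thesis
      using sum by (simp add: lq_space_def)
  qed
  show "(\<lambda>n. x n + y n) \<in> lq_space q"
    using bound[of "lq_norm q x + 1" "lq_norm q y + 1"]
    by (simp add: add_nonneg_pos)
  show "lq_norm q (\<lambda>n. x n + y n) \<le> lq_norm q x + lq_norm q y"
  proof (rule field_le_epsilon)
    fix e :: real assume "e > 0"
    then show "lq_norm q (\<lambda>n. x n + y n) \<le> lq_norm q x + lq_norm q y + e"
      using bound[of "lq_norm q x + e/2" "lq_norm q y + e/2"]
      by (simp add: add_nonneg_pos)
  qed
qed

lemma lq_space_diff:
  assumes "q \<ge> 1" "x \<in> lq_space q" "y \<in> lq_space q"
  shows "(\<lambda>n. x n - y n) \<in> lq_space q"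
  using lq_triangle(1)[of q x "\<lambda>n. - y n"] assms by (simp add: lq_space_def)

lemma Metric_space_lq:
  assumes q: "q \<ge> 1"
  shows "Metric_space (lq_space q) (\<lambda>x y. lq_norm q (\<lambda>n. x n - y n))"
proof
  fix x y z
  show "lq_norm q (\<lambda>n. x n - y n) = lq_norm q (\<lambda>n. y n - x n)"
    by (simp add: lq_norm_def abs_minus_commute)
  assume x: "x \<in> lq_space q" and y: "y \<in> lq_space q"
  show "lq_norm q (\<lambda>n. x n - y n) = 0 \<longleftrightarrow> x = y"
    using lq_norm_eq_0_iff[OF q lq_space_diff[OF q x y]] by auto
  assume z: "z \<in> lq_space q"
  show "lq_norm q (\<lambda>n. x n - z n) \<le> lq_norm q (\<lambda>n. x n - y n) + lq_norm q (\<lambda>n. y n - z n)"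
    using lq_triangle(2)[OF q lq_space_diff[OF q x y] lq_space_diff[OF q y z]] by simp
qed simp

lemma mspace_lq_metric: "q \<ge> 1 \<Longrightarrow> mspace (lq_metric q) = lq_space q"
  and mdist_lq_metric: "q \<ge> 1 \<Longrightarrow> mdist (lq_metric q) x y = lq_norm q (\<lambda>n. x n - y n)"
  using Metric_space.mspace_metric[OF Metric_space_lq] Metric_space.mdist_metric[OF Metric_space_lq]
  by (simp_all add: lq_metric_def)

end

theory Submission
  imports Defs
begin

text \<open>Compose the two quotient maps to a map \<open>h\<close> from a subset of \<open>X\<close> onto \<open>\<ell>\<^sub>q\<close>; it suffices
  to see that such an \<open>h\<close> cannot exist. Since \<open>\<ell>\<^sub>q\<close> is geodesic, \<open>h\<close> is co-Lipschitz for large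
  distances: a point at distance \<open>r\<close> from \<open>h x\<close> has a preimage within \<open>c r\<close> of \<open>x\<close>
  (\<open>lifts_with_cost_of_step\<close>). The Lipschitz condition for large distances keeps the
  admissible \<open>c\<close> away from \<open>0\<close> (\<open>lifting_cost_ge\<close>), so their infimum \<open>C\<close> is positive.

  The two geometries disagree about forks. In \<open>\<ell>\<^sub>q\<close>, a path from \<open>u\<close> to \<open>y\<close> may detour through
  any of infinitely many points that are \<open>\<eta> r\<close> apart, at a relative extra cost of order only
  \<open>\<eta>\<^sup>q\<close> (\<open>lq_fork\<close>). In a space with property \<open>(\<beta>\<^sub>p)\<close>, two steps from one point to
  infinitely many separated tips must, for some tip, fall short of their full length by a relative
  amount of order \<open>\<eta>\<^sup>p\<close> (\<open>property_beta_fork\<close>). Lifting the fork of \<open>\<ell>\<^sub>q\<close> to \<open>X\<close> with cost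
  \<open>c\<close> keeps its branch points separated, again by the Lipschitz condition. One branch therefore
  leads to a preimage of \<open>y\<close> at distance about \<open>c r (1 + O(\<eta>\<^sup>q) - \<delta> \<eta>\<^sup>p)\<close>, with \<open>\<delta> > 0\<close>
  independent of \<open>\<eta>\<close>. As \<open>p < q\<close>, this is at most \<open>\<kappa> c r\<close> with some \<open>\<kappa> < 1\<close> for small \<open>\<eta>\<close>
  (\<open>lifting_cost_improves\<close>), which contradicts the choice of \<open>C\<close> when \<open>c\<close> is near \<open>C\<close>.\<close>

section \<open>Separated forks in \<open>\<ell>\<^sub>q\<close>\<close>

lemma lq_space_scale: "x \<in> lq_space q \<Longrightarrow> (\<lambda>n. a * x n) \<in> lq_space q"
  by (auto simp: lq_space_def abs_mult powr_mult intro: summable_mult)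

lemma lq_norm_scale:
  assumes "q \<ge> 1" "x \<in> lq_space q"
  shows "lq_norm q (\<lambda>n. a * x n) = \<bar>a\<bar> * lq_norm q x"
proof -
  have "(\<Sum>n. \<bar>a * x n\<bar> powr q) = \<bar>a\<bar> powr q * (\<Sum>n. \<bar>x n\<bar> powr q)"
    using assms by (simp add: lq_space_def abs_mult powr_mult suminf_mult)
  then show ?thesis
    using assms by (simp add: lq_norm_def powr_mult powr_powr suminf_nonneg lq_space_def)
qed

lemma lq_norm_commute: "lq_norm q (\<lambda>n. x n - y n) = lq_norm q (\<lambda>n. y n - x n)"
  by (simp add: lq_norm_def abs_minus_commute)

lemma abs_coordinate_le_lq_norm:
  assumes "q \<ge> 1" "x \<in> lq_space q"
  shows "\<bar>x n\<bar> \<le> lq_norm q x"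
proof -
  have "(\<Sum>k\<in>{n}. \<bar>x k\<bar> powr q) \<le> (\<Sum>k. \<bar>x k\<bar> powr q)"
    using assms by (intro sum_le_suminf) (auto simp: lq_space_def)
  then have "\<bar>x n\<bar> powr q \<le> lq_norm q x powr q"
    using lq_norm_powr[OF assms] by simp
  then show ?thesis
    using assms by (meson lq_norm_nonneg not_le powr_less_mono2 order_less_le_trans zero_less_one)
qed

lemma
  assumes q: "q \<ge> 1" and x: "x \<in> lq_space q"
  shows lq_space_fun_upd: "x(n := b) \<in> lq_space q"
    and lq_norm_fun_upd_powr:
      "lq_norm q (x(n := b)) powr q = lq_norm q x powr q - \<bar>x n\<bar> powr q + \<bar>b\<bar> powr q"
proof -
  have "(\<lambda>k. \<bar>x k\<bar> powr q + (if k = n then \<bar>b\<bar> powr q - \<bar>x n\<bar> powr q else 0)) sums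
      (lq_norm q x powr q + (\<bar>b\<bar> powr q - \<bar>x n\<bar> powr q))"
    unfolding lq_norm_powr[OF q x] using x sums_single[of n "\<lambda>_. \<bar>b\<bar> powr q - \<bar>x n\<bar> powr q"]
    by (intro sums_add summable_sums) (auto simp: lq_space_def)
  also have "(\<lambda>k. \<bar>x k\<bar> powr q + (if k = n then \<bar>b\<bar> powr q - \<bar>x n\<bar> powr q else 0)) =
      (\<lambda>k. \<bar>(x(n := b)) k\<bar> powr q)"
    by auto
  finally have s: "(\<lambda>k. \<bar>(x(n := b)) k\<bar> powr q) sums
      (lq_norm q x powr q + (\<bar>b\<bar> powr q - \<bar>x n\<bar> powr q))" .
  show mem: "x(n := b) \<in> lq_space q"
    using sums_summable[OF s] by (simp add: lq_space_def)
  show "lq_norm q (x(n := b)) powr q = lq_norm q x powr q - \<bar>x n\<bar> powr q + \<bar>b\<bar> powr q"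
    using sums_unique[OF s] unfolding lq_norm_powr[OF q mem] by simp
qed

text \<open>The coordinates of \<open>v\<close> tend to \<open>0\<close>, so \<open>v\<close> and \<open>t e\<^sub>n\<close> have almost disjoint supports for
  large \<open>n\<close>, and \<open>q\<close>-th powers of norms of almost disjoint vectors nearly add up.\<close>

lemma eventually_lq_norm_perturb_less:
  assumes q: "q \<ge> 1" and v: "v \<in> lq_space q" and M: "M \<ge> 0"
    and less: "lq_norm q v powr q + \<bar>t\<bar> powr q < M powr q"
  shows "eventually (\<lambda>n. lq_norm q (v(n := v n + t)) < M) sequentially"
proof -
  have "(\<lambda>n. \<bar>v n\<bar> powr q) \<longlonglongrightarrow> 0"
    using v by (auto simp: lq_space_def intro: summable_LIMSEQ_zero)
  then have "(\<lambda>n. (\<bar>v n\<bar> powr q) powr (1 / q)) \<longlonglongrightarrow> 0 powr (1 / q)"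
    using q by (intro tendsto_powr') auto
  then have v0: "v \<longlonglongrightarrow> 0"
    using q by (simp add: powr_powr tendsto_rabs_zero_iff)
  have "(\<lambda>n. lq_norm q v powr q - \<bar>v n\<bar> powr q + \<bar>v n + t\<bar> powr q)
      \<longlonglongrightarrow> lq_norm q v powr q - \<bar>0\<bar> powr q + \<bar>0 + t\<bar> powr q"
    using q by (intro tendsto_intros tendsto_powr' v0) auto
  then have "eventually (\<lambda>n. lq_norm q v powr q - \<bar>v n\<bar> powr q + \<bar>v n + t\<bar> powr q < M powr q)
      sequentially"
    using less q by (intro order_tendstoD) auto
  then show ?thesis
  proof eventually_elim
    case (elim n)
    then have "lq_norm q (v(n := v n + t)) powr q < M powr q"
      using lq_norm_fun_upd_powr[OF q v] by simp
    then show ?case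
      using q M by (meson not_le powr_mono2 order_less_le_trans zero_less_one less_imp_le)
  qed
qed

text \<open>The fork on which the argument rests. From \<open>u\<close> one walks a third of the way towards \<open>y\<close>,
  branches into infinitely many directions \<open>e\<^sub>n\<close>, and returns to \<open>y\<close>. A detour of relative size
  \<open>\<eta>\<close> lengthens the walk only by a relative amount of order \<open>\<eta>\<^sup>q\<close>, although the branch points
  are \<open>\<eta> r\<close> apart. The \<open>4\<close> could be any number above \<open>3\<close>; the excess absorbs the error for
  finite \<open>n\<close>.\<close>

lemma lq_fork:
  assumes q: "q \<ge> 1" and u: "u \<in> lq_space q" and y: "y \<in> lq_space q"
    and r: "r > 0" and uy: "lq_norm q (\<lambda>k. y k - u k) \<le> r" and \<eta>: "\<eta> > 0"
  obtains a m where
    "a \<in> lq_space q" "\<And>n. m n \<in> lq_space q"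
    "lq_norm q (\<lambda>k. a k - u k) \<le> r / 3"
    "\<And>n :: nat. lq_norm q (\<lambda>k. m n k - a k) \<le> r / 3 * (1 + (4 * \<eta>) powr q)"
    "\<And>n. lq_norm q (\<lambda>k. y k - m n k) \<le> r / 3 * (1 + (4 * \<eta>) powr q)"
    "\<And>n j. n \<noteq> j \<Longrightarrow> \<eta> * r \<le> lq_norm q (\<lambda>k. m n k - m j k)"
proof -
  define v where "v = (\<lambda>k. 1 / 3 * (y k - u k))"
  have v: "v \<in> lq_space q"
    unfolding v_def by (intro lq_space_scale lq_space_diff q u y)
  have nv: "lq_norm q v \<le> r / 3"
    unfolding v_def using lq_norm_scale[OF q lq_space_diff[OF q y u], of "1/3"] uy by simp
  define M where "M = r / 3 * (1 + (4 * \<eta>) powr q)"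
  have M0: "M \<ge> 0"
    using r by (simp add: M_def)
  have less: "lq_norm q v powr q + \<bar>t\<bar> powr q < M powr q" if t: "\<bar>t\<bar> = \<eta> * r" for t
  proof -
    have "lq_norm q v powr q + \<bar>t\<bar> powr q \<le> (r / 3) powr q + (r / 3 * (3 * \<eta>)) powr q"
      using nv q t by (intro add_mono powr_mono2) (auto simp: field_simps)
    also have "\<dots> = (r / 3) powr q * (1 + (3 * \<eta>) powr q)"
      using powr_mult[of "r/3" "3 * \<eta>" q] r \<eta> by (simp add: algebra_simps)
    also have "\<dots> < (r / 3) powr q * (1 + (4 * \<eta>) powr q)"
      using r q \<eta> by (intro mult_strict_left_mono add_strict_left_mono powr_less_mono2) auto
    also have "\<dots> \<le> (r / 3) powr q * (1 + (4 * \<eta>) powr q) powr q"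
    proof (intro mult_left_mono)
      have "(1 + (4 * \<eta>) powr q) powr 1 \<le> (1 + (4 * \<eta>) powr q) powr q"
        using q by (intro powr_mono) auto
      moreover have "0 \<le> (4 * \<eta>) powr q"
        by simp
      ultimately show "1 + (4 * \<eta>) powr q \<le> (1 + (4 * \<eta>) powr q) powr q"
        by simp
    qed auto
    also have "\<dots> = M powr q"
      unfolding M_def using r by (intro powr_mult[symmetric])
    finally show ?thesis .
  qed
  have "eventually (\<lambda>n. lq_norm q (v(n := v n + \<eta> * r)) < M \<and> lq_norm q (v(n := v n + (- (\<eta> * r)))) < M)
      sequentially"
    using r \<eta> by (intro eventually_conj eventually_lq_norm_perturb_less less q v M0) (auto simp: abs_mult)
  then obtain n0 where n0: "\<And>n. n \<ge> n0 \<Longrightarrow> lq_norm q (v(n := v n + \<eta> * r)) < M"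
      "\<And>n. n \<ge> n0 \<Longrightarrow> lq_norm q (v(n := v n - \<eta> * r)) < M"
    by (auto simp: eventually_sequentially)
  define a where "a = (\<lambda>k. u k + v k)"
  define b where "b = (\<lambda>k. a k + v k)"
  define m where "m = (\<lambda>n. b(n0 + n := b (n0 + n) + \<eta> * r))"
  have a: "a \<in> lq_space q"
    unfolding a_def by (intro lq_triangle q u v)
  have b: "b \<in> lq_space q"
    unfolding b_def by (intro lq_triangle q a v)
  have m: "m n \<in> lq_space q" for n
    unfolding m_def by (intro lq_space_fun_upd q b)
  show thesis
  proof (rule that[of a m])
    show "lq_norm q (\<lambda>k. a k - u k) \<le> r / 3"
      using nv by (simp add: a_def)
    have "(\<lambda>k. m n k - a k) = v(n0 + n := v (n0 + n) + \<eta> * r)" for n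
      by (auto simp: m_def b_def)
    then show "lq_norm q (\<lambda>k. m n k - a k) \<le> r / 3 * (1 + (4 * \<eta>) powr q)" for n
      using n0(1)[of "n0 + n"] by (simp add: M_def)
    have "(\<lambda>k. y k - m n k) = v(n0 + n := v (n0 + n) - \<eta> * r)" for n
      by (auto simp: m_def b_def a_def v_def fun_eq_iff field_simps)
    then show "lq_norm q (\<lambda>k. y k - m n k) \<le> r / 3 * (1 + (4 * \<eta>) powr q)" for n
      using n0(2)[of "n0 + n"] by (simp add: M_def)
    show "\<eta> * r \<le> lq_norm q (\<lambda>k. m n k - m j k)" if "n \<noteq> j" for n j
      using abs_coordinate_le_lq_norm[OF q lq_space_diff[OF q m m], of n "n0 + n" j] that r \<eta>
      by (simp add: m_def)
  qed (use a m in auto)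
qed


section \<open>Property \<open>(\<beta>\<^sub>p)\<close> shortens forks\<close>

lemma equivalent_norm_minus_commute:
  assumes "equivalent_norm N"
  shows "N (x - y) = N (y - x)"
proof -
  have "N ((- 1) *\<^sub>R (x - y)) = \<bar>- 1\<bar> * N (x - y)"
    using assms unfolding equivalent_norm_def by blast
  then show ?thesis
    by simp
qed

lemma equivalent_norm_triangle_diff:
  assumes "equivalent_norm N"
  shows "N (x - z) \<le> N (x - y) + N (y - z)"
proof -
  have "N ((x - y) + (y - z)) \<le> N (x - y) + N (y - z)"
    using assms unfolding equivalent_norm_def by blast
  then show ?thesis
    by simp
qed

lemma equivalent_norm_nonneg: "equivalent_norm N \<Longrightarrow> 0 \<le> N x"
  unfolding equivalent_norm_def
  by (metis mult_nonneg_nonneg norm_ge_zero order_trans less_imp_le)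

text \<open>The modulus, rescaled to a ball of radius \<open>R\<close> about the centre \<open>z\<close> of a fork: with
  \<open>x\<close> at the root and the \<open>w\<^sub>i\<close> at the tips, some tip is closer to \<open>x\<close> than the
  \<open>2 R\<close> that passing through \<open>z\<close> may cost. Halving \<open>\<gamma>\<close> makes up for the infimum over the tips not being attained.\<close>

lemma property_beta_fork:
  fixes N :: "'a::real_normed_vector \<Rightarrow> real"
  assumes N: "equivalent_norm N" and \<beta>: "property_beta N p"
  obtains \<gamma> where "\<gamma> > 0"
    "\<And>x z R t (w :: nat \<Rightarrow> 'a). \<lbrakk>R > 0; t > 0; N (x - z) \<le> R; \<And>i. N (w i - z) \<le> R;
       \<And>i j. i \<noteq> j \<Longrightarrow> t * R \<le> N (w i - w j)\<rbrakk> \<Longrightarrow> \<exists>i. N (w i - x) \<le> 2 * R * (1 - \<gamma> * t powr p)"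
proof -
  obtain \<gamma> where \<gamma>: "\<gamma> > 0"
    and mod: "\<And>t. t \<ge> 0 \<Longrightarrow> separated_seqs N t \<noteq> {} \<Longrightarrow> beta_modulus N t \<ge> \<gamma> * t powr p"
    using \<beta> unfolding property_beta_def by auto
  have scale: "N (a *\<^sub>R x) = \<bar>a\<bar> * N x" for x a
    using N by (simp add: equivalent_norm_def)
  note minus = equivalent_norm_minus_commute[OF N] and nonneg = equivalent_norm_nonneg[OF N]
  have tri': "N (x - y) \<le> N x + N y" for x y
    using equivalent_norm_triangle_diff[OF N, of x y 0] minus[of 0 y] by simp
  show thesis
  proof (rule that[of "\<gamma> / 2"])
    fix x z :: 'a and R t and w :: "nat \<Rightarrow> 'a"
    assume R: "R > 0" and t: "t > 0" and x: "N (x - z) \<le> R" and w: "\<And>i. N (w i - z) \<le> R"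
      and sep: "\<And>i j. i \<noteq> j \<Longrightarrow> t * R \<le> N (w i - w j)"
    define x' where "x' = (1 / R) *\<^sub>R (x - z)"
    define y where "y = (\<lambda>i. (1 / R) *\<^sub>R (w i - z))"
    have x': "N x' \<le> 1"
      using x R by (simp add: x'_def scale)
    have y1: "N (y i) \<le> 1" for i
      using w R by (simp add: y_def scale)
    have ydiff: "y i - y j = (1 / R) *\<^sub>R (w i - w j)" for i j
      by (simp add: y_def algebra_simps)
    have "t \<le> N (y i - y j)" if "i \<noteq> j" for i j
      using sep[OF that] R unfolding ydiff scale by (simp add: field_simps)
    moreover have "{N (y n - y m) | n m. n \<noteq> m} \<noteq> {}"
      using zero_neq_one by blast
    ultimately have "t \<le> sep N y"
      unfolding sep_def by (intro cInf_greatest) auto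
    then have y: "y \<in> separated_seqs N t"
      using y1 by (simp add: separated_seqs_def)
    let ?A = "{(INF i. N (x - y i) / 2) | x y. N x \<le> 1 \<and> y \<in> separated_seqs N t}"
    have "b \<le> 1" if "b \<in> ?A" for b
    proof -
      from that obtain x y where b: "b = (INF i. N (x - y i) / 2)" "N x \<le> 1" "y \<in> separated_seqs N t"
        by auto
      have "b \<le> N (x - y 0) / 2"
        unfolding b by (intro cINF_lower bdd_belowI2[of _ 0]) (auto simp: nonneg)
      also have "\<dots> \<le> 1"
        using tri'[of x "y 0"] b by (auto simp: separated_seqs_def dest!: spec[of _ 0])
      finally show ?thesis .
    qed
    then have "bdd_above ?A"
      by (auto intro!: bdd_aboveI)
    then have "(INF i. N (x' - y i) / 2) \<le> Sup ?A"
      by (intro cSup_upper) (use x' y in auto)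
    also have "\<dots> \<le> 1 - \<gamma> * t powr p"
      using mod[of t] y t unfolding beta_modulus_def by fastforce
    also have "\<dots> < 1 - \<gamma> / 2 * t powr p"
      using \<gamma> t by simp
    finally obtain i where "N (x' - y i) / 2 < 1 - \<gamma> / 2 * t powr p"
      by (subst (asm) cINF_less_iff) (auto intro!: bdd_belowI2[of _ 0] simp: nonneg)
    moreover have "x' - y i = (1 / R) *\<^sub>R (x - w i)"
      by (simp add: x'_def y_def algebra_simps)
    ultimately have "N (w i - x) \<le> 2 * R * (1 - \<gamma> / 2 * t powr p)"
      using R by (simp only: scale minus[of x]) (simp add: field_simps)
    then show "\<exists>i. N (w i - x) \<le> 2 * R * (1 - \<gamma> / 2 * t powr p)"
      by blast
  qed (use \<gamma> in auto)
qed


section \<open>The cost of lifting at large scales\<close>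

text \<open>In the usual terminology: \<open>f\<close> is co-Lipschitz with constant \<open>c\<close> for distances at least
  \<open>D\<close>.\<close>

definition lifts_with_cost ::
  "('a::real_vector \<Rightarrow> real) \<Rightarrow> 'a set \<Rightarrow> ('a \<Rightarrow> nat \<Rightarrow> real) \<Rightarrow> real \<Rightarrow> real \<Rightarrow> real \<Rightarrow> bool" where
  "lifts_with_cost N Z f q D c \<longleftrightarrow>
     (\<forall>x\<in>Z. \<forall>r\<ge>D. \<forall>y\<in>lq_space q. lq_norm q (\<lambda>k. y k - f x k) \<le> r \<longrightarrow>
        (\<exists>x'\<in>Z. f x' = y \<and> N (x' - x) \<le> c * r))"

lemma lifts_with_costE:
  assumes "lifts_with_cost N Z f q D c" "x \<in> Z" "r \<ge> D" "y \<in> lq_space q"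
    "lq_norm q (\<lambda>k. y k - f x k) \<le> r"
  obtains x' where "x' \<in> Z" "f x' = y" "N (x' - x) \<le> c * r"
  using assms unfolding lifts_with_cost_def by blast

text \<open>Since \<open>\<ell>\<^sub>q\<close> is geodesic, being able to lift steps of one size \<open>\<sigma>\<close> suffices: a segment of
  length \<open>r\<close> is cut into \<open>\<lceil>r / \<sigma>\<rceil> \<le> 2 r / \<sigma>\<close> such steps, and these are lifted one after the
  other.\<close>

lemma lifts_with_cost_of_step:
  assumes N: "equivalent_norm N" and q: "q \<ge> 1" and f: "f \<in> Z \<rightarrow> lq_space q" and \<sigma>: "\<sigma> > 0"
    and step: "\<And>x y. x \<in> Z \<Longrightarrow> y \<in> lq_space q \<Longrightarrow> lq_norm q (\<lambda>k. y k - f x k) \<le> \<sigma> \<Longrightarrow>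
      \<exists>x'\<in>Z. f x' = y \<and> N (x' - x) \<le> 1"
  shows "lifts_with_cost N Z f q \<sigma> (2 / \<sigma>)"
  unfolding lifts_with_cost_def
proof (intro ballI allI impI)
  fix x r y
  assume x: "x \<in> Z" and r: "r \<ge> \<sigma>" and y: "y \<in> lq_space q" and d: "lq_norm q (\<lambda>k. y k - f x k) \<le> r"
  have u: "f x \<in> lq_space q"
    using f x by auto
  define n where "n = nat \<lceil>r / \<sigma>\<rceil>"
  have n_ge: "r / \<sigma> \<le> real n"
    unfolding n_def by (rule real_nat_ceiling_ge)
  have r1: "1 \<le> r / \<sigma>"
    using r \<sigma> by (simp add: field_simps)
  have n_le: "real n \<le> 2 * r / \<sigma>"
    using r1 unfolding n_def by linarith
  have n0: "n > 0"
    using n_ge r1 by linarith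
  define v where "v = (\<lambda>k. y k - f x k)"
  have v: "v \<in> lq_space q"
    unfolding v_def by (intro lq_space_diff q y u)
  have "\<exists>x'\<in>Z. f x' = (\<lambda>k. f x k + real j / real n * v k) \<and> N (x' - x) \<le> real j" for j
  proof (induction j)
    case 0
    have "N (x - x) = 0"
      using N by (simp add: equivalent_norm_def)
    then show ?case
      using x by auto
  next
    case (Suc j)
    then obtain x' where x': "x' \<in> Z" "f x' = (\<lambda>k. f x k + real j / real n * v k)" "N (x' - x) \<le> real j"
      by blast
    let ?y = "\<lambda>k. f x k + real (Suc j) / real n * v k"
    have "(\<lambda>k. ?y k - f x' k) = (\<lambda>k. 1 / real n * v k)"
      using n0 unfolding x' by (auto simp: field_simps)
    moreover have "lq_norm q v \<le> \<sigma> * real n"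
      using d n_ge \<sigma> unfolding v_def by (simp add: field_simps)
    ultimately have "lq_norm q (\<lambda>k. ?y k - f x' k) \<le> \<sigma>"
      using lq_norm_scale[OF q v, of "1 / real n"] n0 by (simp add: divide_le_eq)
    moreover have "?y \<in> lq_space q"
      by (intro lq_triangle lq_space_scale q u v)
    ultimately obtain x'' where x'': "x'' \<in> Z" "f x'' = ?y" "N (x'' - x') \<le> 1"
      using step[OF x'(1)] by blast
    then have "N (x'' - x) \<le> real (Suc j)"
      using equivalent_norm_triangle_diff[OF N, of x'' x x'] x'(3) by simp
    then show ?case
      using x'' by blast
  qed
  from this[of n] obtain x' where "x' \<in> Z" "f x' = y" "N (x' - x) \<le> real n"
    using n0 by (auto simp: v_def)
  then show "\<exists>x'\<in>Z. f x' = y \<and> N (x' - x) \<le> 2 / \<sigma> * r"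
    using n_le by (intro bexI[of _ x']) auto
qed

text \<open>Reaching a point at distance \<open>r\<close> by a move shorter than \<open>r / L\<close> would violate the
  Lipschitz bound. The bound \<open>L\<close> on the effect of moves of length at most \<open>1\<close> is harmless once
  \<open>r > L\<close>.\<close>

lemma lifting_cost_ge:
  assumes q: "q \<ge> 1" and f: "f \<in> Z \<rightarrow> lq_space q" and Z: "Z \<noteq> {}" and L: "L > 0"
    and lip: "\<And>x x'. x \<in> Z \<Longrightarrow> x' \<in> Z \<Longrightarrow> lq_norm q (\<lambda>k. f x' k - f x k) \<le> L * max 1 (N (x' - x))"
    and lifts: "lifts_with_cost N Z f q D c"
  shows "1 / L \<le> c"
proof -
  obtain x where x: "x \<in> Z"
    using Z by blast
  have u: "f x \<in> lq_space q"
    using f x by auto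
  define r where "r = max D (2 * L)"
  have r: "r \<ge> D" "r > L" "r > 0"
    using L by (auto simp: r_def)
  define y where "y = (f x)(0 := f x 0 + r)"
  have y: "y \<in> lq_space q"
    unfolding y_def by (intro lq_space_fun_upd q u)
  have "(\<lambda>k. \<bar>y k - f x k\<bar> powr q) = (\<lambda>k. if k = 0 then r powr q else 0)"
    using r by (auto simp: y_def)
  then have "lq_norm q (\<lambda>k. y k - f x k) = (r powr q) powr (1 / q)"
    using sums_unique[OF sums_single[of 0 "\<lambda>_. r powr q"]] by (simp add: lq_norm_def)
  then have d: "lq_norm q (\<lambda>k. y k - f x k) = r"
    using q r by (simp add: powr_powr)
  obtain x' where x': "x' \<in> Z" "f x' = y" "N (x' - x) \<le> c * r"
    using lifts_with_costE[OF lifts x r(1) y] d by auto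
  have "r \<le> L * max 1 (N (x' - x))"
    using lip[OF x x'(1)] x'(2) d by simp
  moreover have "L * max 1 (N (x' - x)) \<le> L * max 1 (c * r)"
    using x'(3) L by (intro mult_left_mono) auto
  ultimately have "r \<le> L * max 1 (c * r)"
    by linarith
  then have "1 * r \<le> (L * c) * r"
    using r by (auto simp: max_def split: if_splits)
  then show ?thesis
    using r L by (simp add: field_simps)
qed

lemma exists_detour_size:
  fixes p q A :: real
  assumes "p < q" and "A > 0"
  obtains \<eta> where "\<eta> > 0" "4 * \<eta> \<le> 1" "(4 * \<eta>) powr q \<le> A * \<eta> powr p"
proof -
  define K where "K = A / 4 powr q"
  define \<eta> where "\<eta> = min (1 / 4) (K powr (1 / (q - p)))"
  have K: "K > 0"
    using assms by (simp add: K_def)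
  have \<eta>: "\<eta> > 0" "4 * \<eta> \<le> 1"
    using K by (auto simp: \<eta>_def)
  have "\<eta> powr (q - p) \<le> (K powr (1 / (q - p))) powr (q - p)"
    using assms \<eta> by (intro powr_mono2) (auto simp: \<eta>_def)
  also have "\<dots> = K"
    using assms K by (simp add: powr_powr)
  finally have "\<eta> powr (q - p) * \<eta> powr p \<le> K * \<eta> powr p"
    by (intro mult_right_mono) auto
  then have "4 powr q * \<eta> powr q \<le> 4 powr q * (K * \<eta> powr p)"
    by (simp flip: powr_add)
  then have "(4 * \<eta>) powr q \<le> A * \<eta> powr p"
    using \<eta> by (simp add: powr_mult K_def)
  then show thesis
    using that \<eta> by blast
qed

text \<open>The heart of the proof. To lift \<open>y\<close> from \<open>x\<close>, walk along the fork of \<open>lq_fork\<close>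
  between \<open>f x\<close> and \<open>y\<close>. Lifted naively, the walk costs \<open>c r (1 + (4 \<eta>)\<^sup>q)\<close>; but the lifted branch
  points \<open>w\<^sub>n\<close> remain separated by a multiple of \<open>\<eta> r\<close>, so one of them is nearer to \<open>x\<close> than
  expected by a multiple of \<open>\<eta>\<^sup>p r\<close>. As \<open>q > p\<close>, the gain exceeds the loss for small \<open>\<eta>\<close>. The
  factor \<open>\<kappa>\<close> depends only on an upper bound \<open>c\<^sub>1\<close> for the cost, so that it can be fixed before a
  cost near the infimum is selected.\<close>

lemma lifting_cost_improves:
  assumes N: "equivalent_norm N" and \<beta>: "property_beta N p" and q: "q \<ge> 1" and pq: "p < q"
    and f: "f \<in> Z \<rightarrow> lq_space q" and Z: "Z \<noteq> {}" and L: "L > 0"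
    and lip: "\<And>x x'. x \<in> Z \<Longrightarrow> x' \<in> Z \<Longrightarrow> lq_norm q (\<lambda>k. f x' k - f x k) \<le> L * max 1 (N (x' - x))"
    and c1: "c\<^sub>1 > 0"
  obtains \<kappa> where "0 < \<kappa>" "\<kappa> < 1"
    "\<And>D c. D > 0 \<Longrightarrow> c \<le> c\<^sub>1 \<Longrightarrow> lifts_with_cost N Z f q D c \<Longrightarrow>
       \<exists>D'>0. lifts_with_cost N Z f q D' (\<kappa> * c)"
proof -
  obtain \<gamma> where \<gamma>: "\<gamma> > 0" and fork:
    "\<And>x z R t (w :: nat \<Rightarrow> 'a). \<lbrakk>R > 0; t > 0; N (x - z) \<le> R; \<And>i. N (w i - z) \<le> R;
       \<And>i j. i \<noteq> j \<Longrightarrow> t * R \<le> N (w i - w j)\<rbrakk> \<Longrightarrow> \<exists>i. N (w i - x) \<le> 2 * R * (1 - \<gamma> * t powr p)"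
    using property_beta_fork[OF N \<beta>] by blast
  \<comment> \<open>\<open>\<tau> \<eta>\<close> bounds from below the separation of the lifted branch points, relative to the length
    \<open>R\<close> of a lifted edge.\<close>
  define \<tau> where "\<tau> = 3 / (2 * L * c\<^sub>1)"
  have \<tau>: "\<tau> > 0"
    using L c1 by (simp add: \<tau>_def)
  obtain \<eta> where \<eta>: "\<eta> > 0" "4 * \<eta> \<le> 1" and small: "(4 * \<eta>) powr q \<le> 2 / 3 * \<gamma> * \<tau> powr p * \<eta> powr p"
    using exists_detour_size[OF pq, of "2 / 3 * \<gamma> * \<tau> powr p"] \<gamma> \<tau> by auto
  define h where "h = (4 * \<eta>) powr q"
  define g where "g = 2 / 3 * (\<gamma> * (\<tau> * \<eta>) powr p)"
  have h0: "h > 0"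
    using \<eta> by (simp add: h_def)
  have h1: "h \<le> 1"
    using \<eta> q powr_mono2[of q "4 * \<eta>" 1] by (simp add: h_def)
  have hg: "h \<le> g"
    using small \<tau> \<eta> by (simp add: h_def g_def powr_mult)
  define \<kappa> where "\<kappa> = max (1 / 2) ((1 + h) * (1 - g))"
  have "0 < h * g"
    using h0 hg by (intro mult_pos_pos) auto
  then have "(1 + h) * (1 - g) < 1"
    using hg by (simp add: algebra_simps)
  then have \<kappa>: "0 < \<kappa>" "\<kappa> < 1"
    by (auto simp: \<kappa>_def)
  show thesis
  proof (rule that[OF \<kappa>])
    fix D c
    assume D: "D > 0" and cc1: "c \<le> c\<^sub>1" and lifts: "lifts_with_cost N Z f q D c"
    have c: "c > 0"
      using lifting_cost_ge[OF q f Z L lip lifts] L by (meson divide_pos_pos less_le_trans zero_less_one)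
    define D' where "D' = max (3 * D) (2 * L / \<eta>)"
    have "lifts_with_cost N Z f q D' (\<kappa> * c)"
      unfolding lifts_with_cost_def
    proof (intro ballI allI impI)
      fix x r y
      assume x: "x \<in> Z" and r: "r \<ge> D'" and y: "y \<in> lq_space q"
        and d: "lq_norm q (\<lambda>k. y k - f x k) \<le> r"
      have u: "f x \<in> lq_space q"
        using f x by auto
      have r0: "r > 0" and rD: "r / 3 \<ge> D" and r\<eta>: "L < \<eta> * r"
        using r D \<eta> L by (auto simp: D'_def field_simps)
      obtain a m where a: "a \<in> lq_space q" and m: "\<And>n. m n \<in> lq_space q"
        and au: "lq_norm q (\<lambda>k. a k - f x k) \<le> r / 3"
        and ma: "\<And>n :: nat. lq_norm q (\<lambda>k. m n k - a k) \<le> r / 3 * (1 + h)"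
        and ym: "\<And>n. lq_norm q (\<lambda>k. y k - m n k) \<le> r / 3 * (1 + h)"
        and sep: "\<And>n j. n \<noteq> j \<Longrightarrow> \<eta> * r \<le> lq_norm q (\<lambda>k. m n k - m j k)"
        using lq_fork[OF q u y r0 d \<eta>(1)] unfolding h_def by blast
      define R where "R = c * (r / 3 * (1 + h))"
      have R0: "R > 0"
        using c r0 h0 by (simp add: R_def)
      have rh: "r / 3 \<le> r / 3 * (1 + h)"
        using r0 h0 by (simp add: field_simps)
      then have cr: "c * (r / 3) \<le> R"
        unfolding R_def using c by (intro mult_left_mono) auto
      have rDh: "r / 3 * (1 + h) \<ge> D"
        using rh rD by linarith
      obtain z where z: "z \<in> Z" "f z = a" "N (z - x) \<le> c * (r / 3)"
        using lifts_with_costE[OF lifts x rD a au] by blast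
      have zx: "N (x - z) \<le> R"
        using z(3) cr equivalent_norm_minus_commute[OF N, of x z] by linarith
      have "\<exists>w. w \<in> Z \<and> f w = m n \<and> N (w - z) \<le> R" for n
      proof -
        have "lq_norm q (\<lambda>k. m n k - f z k) \<le> r / 3 * (1 + h)"
          using ma z(2) by simp
        from lifts_with_costE[OF lifts z(1) rDh m this] show ?thesis
          unfolding R_def by blast
      qed
      then obtain w where w: "\<And>n. w n \<in> Z" "\<And>n. f (w n) = m n" "\<And>n. N (w n - z) \<le> R"
        by metis
      have "\<tau> * \<eta> * R \<le> N (w i - w j)" if "i \<noteq> j" for i j
      proof -
        have le: "\<eta> * r \<le> L * max 1 (N (w i - w j))"
          using lip[OF w(1)[of j] w(1)[of i]] sep[OF that] by (simp add: w)
        \<comment> \<open>The branch points are so far apart that the Lipschitz bound is not the trivial one.\<close>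
        then have "\<eta> * r \<le> L * N (w i - w j)"
          using r\<eta> L by (auto simp: max_def split: if_splits)
        moreover have "\<tau> * \<eta> * R \<le> \<eta> * r / L"
        proof -
          have "c * (1 + h) \<le> c\<^sub>1 * 2"
            using cc1 c c1 h0 h1 by (intro mult_mono) auto
          then have "R \<le> c\<^sub>1 * 2 * (r / 3)"
            unfolding R_def using mult_right_mono[of "c * (1 + h)" "c\<^sub>1 * 2" "r / 3"] r0
            by (simp add: mult_ac)
          then have "\<tau> * \<eta> * R \<le> \<tau> * \<eta> * (c\<^sub>1 * 2 * (r / 3))"
            using \<tau> \<eta> by (intro mult_left_mono) auto
          also have "\<dots> = \<eta> * r / L"
            using c1 L by (simp add: \<tau>_def field_simps)
          finally show ?thesis .
        qed
        ultimately show ?thesis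
          using L by (smt (verit) divide_le_eq mult.commute)
      qed
      then obtain i where i: "N (w i - x) \<le> 2 * R * (1 - \<gamma> * (\<tau> * \<eta>) powr p)"
        using fork[of R "\<tau> * \<eta>" x z w] R0 \<tau> \<eta> zx w(3) by auto
      obtain x' where x': "x' \<in> Z" "f x' = y" "N (x' - w i) \<le> R"
      proof -
        have "lq_norm q (\<lambda>k. y k - f (w i) k) \<le> r / 3 * (1 + h)"
          using ym w(2) by simp
        from lifts_with_costE[OF lifts w(1) rDh y this] show thesis
          using that unfolding R_def by blast
      qed
      have "N (x' - x) \<le> R + 2 * R * (1 - \<gamma> * (\<tau> * \<eta>) powr p)"
        using equivalent_norm_triangle_diff[OF N, of x' x "w i"] i x'(3) by linarith
      also have "\<dots> = 3 * R * (1 - g)"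
        by (simp add: g_def algebra_simps)
      also have "\<dots> = ((1 + h) * (1 - g)) * (c * r)"
        by (simp add: R_def)
      also have "\<dots> \<le> \<kappa> * (c * r)"
        using c r0 by (intro mult_right_mono) (auto simp: \<kappa>_def)
      finally show "\<exists>x'\<in>Z. f x' = y \<and> N (x' - x) \<le> \<kappa> * c * r"
        using x' by (auto simp: mult_ac)
    qed
    moreover have "D' > 0"
      using D by (simp add: D'_def)
    ultimately show "\<exists>D'>0. lifts_with_cost N Z f q D' (\<kappa> * c)"
      by blast
  qed
qed

text \<open>The infimum \<open>C\<close> of all lifting costs is positive, yet a cost close enough to \<open>C\<close> can be
  improved to one below \<open>C\<close>.\<close>

lemma no_lifting_with_property_beta:
  assumes N: "equivalent_norm N" and \<beta>: "property_beta N p" and q: "q \<ge> 1" and pq: "p < q"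
    and f: "f \<in> Z \<rightarrow> lq_space q" and Z: "Z \<noteq> {}" and L: "L > 0"
    and lip: "\<And>x x'. x \<in> Z \<Longrightarrow> x' \<in> Z \<Longrightarrow> lq_norm q (\<lambda>k. f x' k - f x k) \<le> L * max 1 (N (x' - x))"
    and D0: "D\<^sub>0 > 0"
  shows "\<not> lifts_with_cost N Z f q D\<^sub>0 c\<^sub>0"
proof
  assume lifts: "lifts_with_cost N Z f q D\<^sub>0 c\<^sub>0"
  define K where "K = {c. \<exists>D>0. lifts_with_cost N Z f q D c}"
  have K_ne: "K \<noteq> {}"
    using lifts D0 by (auto simp: K_def)
  have K_ge: "1 / L \<le> c" if "c \<in> K" for c
    using that lifting_cost_ge[OF q f Z L lip] by (auto simp: K_def)
  define C where "C = Inf K"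
  have "1 / L \<le> C"
    unfolding C_def using K_ne K_ge by (rule cInf_greatest)
  then have C: "C > 0"
    using L by (meson divide_pos_pos less_le_trans zero_less_one)
  obtain \<kappa> where \<kappa>: "0 < \<kappa>" "\<kappa> < 1" and improve:
    "\<And>D c. D > 0 \<Longrightarrow> c \<le> 2 * C \<Longrightarrow> lifts_with_cost N Z f q D c \<Longrightarrow>
       \<exists>D'>0. lifts_with_cost N Z f q D' (\<kappa> * c)"
    using lifting_cost_improves[OF N \<beta> q pq f Z L lip, of "2 * C"] C by auto
  have "C < min (C / \<kappa>) (2 * C)"
    using C \<kappa> by (simp add: field_simps)
  then obtain c where c: "c \<in> K" "c < C / \<kappa>" "c < 2 * C"
    using cInf_lessD[OF K_ne, of "min (C / \<kappa>) (2 * C)"] by (auto simp: C_def)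
  then have "\<kappa> * c \<in> K"
    using improve[of _ c] by (auto simp: K_def)
  then have "C \<le> \<kappa> * c"
    unfolding C_def using K_ge by (intro cInf_lower bdd_belowI) auto
  then show False
    using c(2) \<kappa> by (simp add: field_simps)
qed


section \<open>Composition of uniform quotient maps\<close>

lemma uniform_quotient_mapD_ball:
  assumes "uniform_quotient_map M N f" and "r > 0"
  obtains \<sigma> where "\<sigma> > 0" "\<And>x. x \<in> mspace M \<Longrightarrow> mcball_of N (f x) \<sigma> \<subseteq> f ` mcball_of M x r"
  using assms unfolding uniform_quotient_map_def by meson

lemma lipschitz_for_large_distancesD:
  assumes "lipschitz_for_large_distances M N f" and "s > 0"
  obtains L where "L > 0"
    "\<And>x y. x \<in> mspace M \<Longrightarrow> y \<in> mspace M \<Longrightarrow> mdist N (f x) (f y) \<le> L * max s (mdist M x y)"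
proof -
  obtain L where L: "L > 0" "\<And>r x. r \<ge> s \<Longrightarrow> x \<in> mspace M \<Longrightarrow>
      f ` mcball_of M x r \<subseteq> mcball_of N (f x) (L * r)"
    using assms unfolding lipschitz_for_large_distances_def by meson
  show thesis
  proof (rule that[OF L(1)])
    fix x y assume xy: "x \<in> mspace M" "y \<in> mspace M"
    then have "y \<in> mcball_of M x (max s (mdist M x y))"
      by simp
    then have "f y \<in> mcball_of N (f x) (L * max s (mdist M x y))"
      using L(2)[of "max s (mdist M x y)" x] xy(1) by (meson image_subset_iff max.cobounded1)
    then show "mdist N (f x) (f y) \<le> L * max s (mdist M x y)"
      by simp
  qed
qed

text \<open>The image is open, and so is its complement, because all points of the image have balls of
  one common radius inside it; a normed space is connected.\<close>

lemma uniform_quotient_map_surj: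
  fixes f :: "'a \<Rightarrow> 'b::real_normed_vector"
  assumes "uniform_quotient_map M euclidean_metric f"
  shows "f ` mspace M = UNIV"
proof -
  obtain \<sigma> where \<sigma>: "\<sigma> > 0"
    "\<And>x. x \<in> mspace M \<Longrightarrow> mcball_of euclidean_metric (f x) \<sigma> \<subseteq> f ` mcball_of M x 1"
    using uniform_quotient_mapD_ball[OF assms, of 1] by auto
  have near: "b \<in> f ` mspace M" if ab: "a \<in> f ` mspace M" "dist a b \<le> \<sigma>" for a b
  proof -
    obtain x where x: "x \<in> mspace M" "a = f x"
      using ab(1) by blast
    have "b \<in> mcball_of euclidean_metric (f x) \<sigma>"
      using ab(2) x by simp
    then show ?thesis
      using \<sigma>(2)[OF x(1)] by auto
  qed
  have "open (f ` mspace M)"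
    unfolding open_dist using near \<sigma>(1) by (metis dist_commute less_imp_le)
  moreover have "open (- f ` mspace M)"
    unfolding open_dist using near \<sigma>(1) by (metis ComplD ComplI less_imp_le)
  moreover have "f ` mspace M \<noteq> {}"
    using assms by (simp add: uniform_quotient_map_def)
  ultimately show ?thesis
    using clopen[of "f ` mspace M"] by (auto simp: closed_def)
qed

text \<open>The domain \<open>{x \<in> Z. f x \<in> S}\<close> of the composite inherits the quotient property of \<open>f\<close>,
  because preimages of points of \<open>S\<close> lie in it automatically. It is nonempty since \<open>f\<close> is onto.\<close>

theorem theorem4p6:
  fixes p q :: real
  assumes p: "1 < p"
    and X: "\<exists>N :: 'a::banach \<Rightarrow> real. equivalent_norm N \<and> property_beta N p"
    and Y: "\<exists>(Z :: 'a set) (f :: 'a \<Rightarrow> 'b::banach).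
              uniform_quotient_map (submetric euclidean_metric Z) euclidean_metric f \<and>
              lipschitz_for_large_distances (submetric euclidean_metric Z) euclidean_metric f"
    and q: "p < q"
  shows "\<nexists>(S :: 'b set) (g :: 'b \<Rightarrow> (nat \<Rightarrow> real)).
              uniform_quotient_map (submetric euclidean_metric S) (lq_metric q) g \<and>
              lipschitz_for_large_distances (submetric euclidean_metric S) (lq_metric q) g"
proof
  assume "\<exists>(S :: 'b set) (g :: 'b \<Rightarrow> (nat \<Rightarrow> real)).
              uniform_quotient_map (submetric euclidean_metric S) (lq_metric q) g \<and>
              lipschitz_for_large_distances (submetric euclidean_metric S) (lq_metric q) g"
  then obtain S :: "'b set" and g :: "'b \<Rightarrow> (nat \<Rightarrow> real)" where
    g: "uniform_quotient_map (submetric euclidean_metric S) (lq_metric q) g"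
      "lipschitz_for_large_distances (submetric euclidean_metric S) (lq_metric q) g"
    by blast
  obtain Z :: "'a set" and f :: "'a \<Rightarrow> 'b" where
    f: "uniform_quotient_map (submetric euclidean_metric Z) euclidean_metric f"
      "lipschitz_for_large_distances (submetric euclidean_metric Z) euclidean_metric f"
    using Y by blast
  obtain N :: "'a \<Rightarrow> real" where N: "equivalent_norm N" and \<beta>: "property_beta N p"
    using X by blast
  obtain c C where c: "c > 0" and C: "C > 0"
    and cN: "\<And>x. c * norm x \<le> N x" and NC: "\<And>x. N x \<le> C * norm x"
    using N unfolding equivalent_norm_def by blast
  have q1: "q \<ge> 1"
    using p q by simp
  note lq [simp] = mspace_lq_metric[OF q1] mdist_lq_metric[OF q1]
  define W where "W = {x \<in> Z. f x \<in> S}"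
  define h where "h = (\<lambda>x. g (f x))"

  have g_mem: "g \<in> S \<rightarrow> lq_space q" and S: "S \<noteq> {}"
    using g(1) by (auto simp: uniform_quotient_map_def)
  then have h: "h \<in> W \<rightarrow> lq_space q"
    by (auto simp: h_def W_def)
  obtain b where b: "b \<in> S"
    using S by blast
  then have "b \<in> f ` Z"
    using uniform_quotient_map_surj[OF f(1)] by simp
  then have W: "W \<noteq> {}"
    using b by (auto simp: W_def)

  obtain \<sigma>\<^sub>f where \<sigma>f: "\<sigma>\<^sub>f > 0" "\<And>x. x \<in> Z \<Longrightarrow>
      mcball_of euclidean_metric (f x) \<sigma>\<^sub>f \<subseteq> f ` mcball_of (submetric euclidean_metric Z) x (1 / C)"
    using uniform_quotient_mapD_ball[OF f(1), of "1 / C"] C by auto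
  obtain \<sigma> where \<sigma>: "\<sigma> > 0" "\<And>x. x \<in> S \<Longrightarrow>
      mcball_of (lq_metric q) (g x) \<sigma> \<subseteq> g ` mcball_of (submetric euclidean_metric S) x \<sigma>\<^sub>f"
    using uniform_quotient_mapD_ball[OF g(1) \<sigma>f(1)] by auto
  have "\<exists>x'\<in>W. h x' = y \<and> N (x' - x) \<le> 1"
    if x: "x \<in> W" and y: "y \<in> lq_space q" and d: "lq_norm q (\<lambda>k. y k - h x k) \<le> \<sigma>" for x y
  proof -
    have xZ: "x \<in> Z" "f x \<in> S"
      using x by (auto simp: W_def)
    have "y \<in> mcball_of (lq_metric q) (g (f x)) \<sigma>"
      using h x y d lq_norm_commute[of q y "h x"] by (auto simp: h_def)
    then have "y \<in> g ` mcball_of (submetric euclidean_metric S) (f x) \<sigma>\<^sub>f"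
      using \<sigma>(2)[OF xZ(2)] by blast
    then obtain b where b: "b \<in> S" "y = g b" "dist (f x) b \<le> \<sigma>\<^sub>f"
      by auto
    then have "b \<in> mcball_of euclidean_metric (f x) \<sigma>\<^sub>f"
      by simp
    then have "b \<in> f ` mcball_of (submetric euclidean_metric Z) x (1 / C)"
      using \<sigma>f(2)[OF xZ(1)] by blast
    then obtain x' where x': "x' \<in> Z" "b = f x'" "dist x x' \<le> 1 / C"
      by auto
    have "N (x' - x) \<le> C * dist x x'"
      using NC[of "x' - x"] by (simp add: dist_norm norm_minus_commute)
    also have "\<dots> \<le> 1"
      using x'(3) C by (simp add: field_simps)
    finally show ?thesis
      using x' b by (auto simp: W_def h_def)
  qed
  then have lifts: "lifts_with_cost N W h q \<sigma> (2 / \<sigma>)"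
    by (intro lifts_with_cost_of_step N q1 h \<sigma>(1))

  \<comment> \<open>The thresholds are chosen so that each bound is homogeneous in \<open>max 1 (N (x' - x))\<close>.\<close>
  obtain L\<^sub>f where Lf: "L\<^sub>f > 0"
    "\<And>x y. x \<in> Z \<Longrightarrow> y \<in> Z \<Longrightarrow> dist (f x) (f y) \<le> L\<^sub>f * max (1 / c) (dist x y)"
    using lipschitz_for_large_distancesD[OF f(2), of "1 / c"] c by auto
  have Lfc: "L\<^sub>f / c > 0"
    using Lf(1) c by simp
  obtain L\<^sub>g where Lg: "L\<^sub>g > 0"
    "\<And>x y. x \<in> S \<Longrightarrow> y \<in> S \<Longrightarrow> lq_norm q (\<lambda>k. g x k - g y k) \<le> L\<^sub>g * max (L\<^sub>f / c) (dist x y)"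
    using lipschitz_for_large_distancesD[OF g(2) Lfc] by auto
  have lip: "lq_norm q (\<lambda>k. h x' k - h x k) \<le> L\<^sub>g * (L\<^sub>f / c) * max 1 (N (x' - x))"
    if "x \<in> W" "x' \<in> W" for x x'
  proof -
    let ?m = "max 1 (N (x' - x))"
    have "dist x' x \<le> 1 / c * ?m"
      using cN[of "x' - x"] c by (simp add: dist_norm field_simps)
    then have "max (1 / c) (dist x' x) \<le> 1 / c * ?m"
      using c by (simp add: divide_right_mono)
    then have "L\<^sub>f * max (1 / c) (dist x' x) \<le> L\<^sub>f * (1 / c * ?m)"
      using Lf(1) by (intro mult_left_mono) auto
    then have "dist (f x') (f x) \<le> L\<^sub>f * (1 / c * ?m)"
      using Lf(2)[of x' x] that unfolding W_def by force
    then have "max (L\<^sub>f / c) (dist (f x') (f x)) \<le> L\<^sub>f / c * ?m"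
      using mult_left_mono[of 1 ?m "L\<^sub>f / c"] Lfc by simp
    then have "L\<^sub>g * max (L\<^sub>f / c) (dist (f x') (f x)) \<le> L\<^sub>g * (L\<^sub>f / c * ?m)"
      using Lg(1) by (intro mult_left_mono) auto
    then show ?thesis
      using Lg(2)[of "f x'" "f x"] that by (simp add: W_def h_def mult_ac)
  qed
  have "L\<^sub>g * (L\<^sub>f / c) > 0"
    using Lg(1) Lfc by (rule mult_pos_pos)
  then show False
    using no_lifting_with_property_beta[OF N \<beta> q1 q h W _ lip \<sigma>(1)] lifts by blast
qed

end
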